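(* Let $a>b$ and $0<k<1$. In the coordinate system $$x=\frac{f_1(s_1)f_2(s_2)}{\sqrt{a-b}},\qquad y=\frac{g_1(s_1)g_2(s_2)}{\sqrt{a-b}},$$ where $$f_1(s_1)=\alpha_1\operatorname{sn}(s_1,k),\quad g_1(s_1)=\beta_1\operatorname{dn}(s_1,k),\quad f_2(s_2)=\alpha_2\frac1{\operatorname{sn}(s_2,k)},\quad g_2(s_2)=\beta_2\frac{\operatorname{cn}(s_2,k)}{\operatorname{sn}(s_2,k)},$$ $$\alpha_1=k\sqrt{a-b},\qquad\alpha_2=\beta_1=\beta_2=\sqrt{a-b},$$ the points $(x,y)$ with $s_1+s_2=\xi=\mathrm{const}$ lie on straight lines. The same is true for points $(x,y)$ with $s_2-s_1=\eta=\mathrm{const}$. Moreover, all these lines are tangent to the hyperbola $$\mathcal H_0:\quad\frac{x^2}{a_0}-\frac{y^2}{c_0}=1,\qquad a_0=k^2(a-b),\quad c_0=(1-k^2)(a-b).$$ This hyperbola belongs to the confocal family $\dfrac{x^2}{a+\lambda}+\dfrac{y^2}{b+\lambda}=1$.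
   Context: $\operatorname{sn},\operatorname{cn},\operatorname{dn}$ are the Jacobi elliptic functions with modulus $k$; $s_1,s_2$ are real parameters for which the expressions are defined; $\lambda\in\mathbb R$ is the parameter of the confocal family. *)

theory Defs
  imports "HOL-Analysis.Analysis"
begin

text \<open>
  Jacobi elliptic functions of a real argument with modulus \<open>k\<close> (not the parameter
  \<open>m = k\<^sup>2\<close>), obtained by inverting the incomplete elliptic integral of the first kind.
  The interval integral is oriented, so \<open>elliptic_F\<close> is odd in \<open>\<phi>\<close>; for \<open>0 \<le> k < 1\<close> its
  integrand is continuous and at least 1, so that \<open>elliptic_F _ k\<close> is a bijection of the
  real line and the definite description below denotes.
\<close>

definition elliptic_F :: "real \<Rightarrow> real \<Rightarrow> real" where
  "elliptic_F \<phi> k = (LBINT t=0..\<phi>. 1 / sqrt (1 - k\<^sup>2 * (sin t)\<^sup>2))"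

definition jacobi_am :: "real \<Rightarrow> real \<Rightarrow> real" where
  "jacobi_am u k = (THE \<phi>. elliptic_F \<phi> k = u)"

definition jacobi_sn :: "real \<Rightarrow> real \<Rightarrow> real" where
  "jacobi_sn u k = sin (jacobi_am u k)"

definition jacobi_cn :: "real \<Rightarrow> real \<Rightarrow> real" where
  "jacobi_cn u k = cos (jacobi_am u k)"

definition jacobi_dn :: "real \<Rightarrow> real \<Rightarrow> real" where
  "jacobi_dn u k = sqrt (1 - k\<^sup>2 * (sin (jacobi_am u k))\<^sup>2)"

definition straight_line :: "(real \<times> real) set \<Rightarrow> bool" where
  "straight_line L \<longleftrightarrow> affine L \<and> aff_dim L = 1"

definition hyperbola :: "real \<Rightarrow> real \<Rightarrow> (real \<times> real) set" where
  "hyperbola A C = {(x, y). x\<^sup>2 / A - y\<^sup>2 / C = 1}"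

definition confocal_conic :: "real \<Rightarrow> real \<Rightarrow> real \<Rightarrow> (real \<times> real) set" where
  "confocal_conic a b l = {(x, y). x\<^sup>2 / (a + l) + y\<^sup>2 / (b + l) = 1}"

text \<open>
  Tangency is understood in the real projective plane with homogeneous coordinates
  \<open>(X, Y, Z)\<close>, where the affine point \<open>(x, y)\<close> is \<open>(x, y, 1)\<close>. The tangent at a smooth point
  \<open>P\<close> of the curve \<open>F = 0\<close>, with \<open>F\<close> homogeneous, is the projective line \<open>dF(P) = 0\<close>
  (it passes through \<open>P\<close> by Euler's identity); \<open>L\<close> is its affine part. For a hyperbola,
  contact at a point with \<open>Z \<noteq> 0\<close> is ordinary tangency, and the tangents at its two
  points at infinity are its asymptotes. The latter case cannot be left out here: the line
  \<open>s\<^sub>1 + s\<^sub>2 = \<xi>\<close> passes through the centre exactly when \<open>cn \<xi> = 0\<close>, and is then an asymptote.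
\<close>

definition proj_tangent_at ::
  "(real \<times> real \<times> real \<Rightarrow> real) \<Rightarrow> real \<times> real \<times> real \<Rightarrow> (real \<times> real) set \<Rightarrow> bool" where
  "proj_tangent_at F P L \<longleftrightarrow> P \<noteq> 0 \<and> F P = 0 \<and>
     (\<exists>D. (F has_derivative D) (at P) \<and> D \<noteq> (\<lambda>_. 0) \<and> L = {(x, y). D (x, y, 1) = 0})"

definition hyperbola_form :: "real \<Rightarrow> real \<Rightarrow> real \<times> real \<times> real \<Rightarrow> real" where
  "hyperbola_form A C = (\<lambda>(X, Y, Z). X\<^sup>2 / A - Y\<^sup>2 / C - Z\<^sup>2)"

definition tangent_to_hyperbola :: "real \<Rightarrow> real \<Rightarrow> (real \<times> real) set \<Rightarrow> bool" where
  "tangent_to_hyperbola A C L \<longleftrightarrow> (\<exists>P. proj_tangent_at (hyperbola_form A C) P L)"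

definition affinely_tangent_to_hyperbola :: "real \<Rightarrow> real \<Rightarrow> (real \<times> real) set \<Rightarrow> bool" where
  "affinely_tangent_to_hyperbola A C L \<longleftrightarrow>
     (\<exists>(x, y) \<in> hyperbola A C. proj_tangent_at (hyperbola_form A C) (x, y, 1) L)"

end

theory Submission imports Defs begin

text \<open>
  In the normalisation \<open>d = sqrt (a - b)\<close> the coordinates are \<open>x = k d sn s\<^sub>1 / sn s\<^sub>2\<close> and
  \<open>y = d dn s\<^sub>1 cn s\<^sub>2 / sn s\<^sub>2\<close>. Everything rests on one consequence of the addition theorems,
  which is linear in \<open>sn u\<close>, \<open>sn v\<close> and \<open>dn u cn v\<close> with coefficients depending on \<open>u + v\<close> only
  (lemma \<open>jacobi_incidence\<close>):
  \<open>dn (u + v) sn u + cn (u + v) sn v = sn (u + v) dn u cn v\<close>.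
  Multiplied by \<open>d / sn v\<close>, it says that for \<open>s\<^sub>1 + s\<^sub>2 = w\<close> the point \<open>(x, y)\<close> lies on the line
  \<open>(dn w / k) x - (sn w) y + d cn w = 0\<close>. Reflecting \<open>s\<^sub>1\<close> changes the sign of \<open>x\<close> and fixes \<open>y\<close>, so
  \<open>s\<^sub>2 - s\<^sub>1 = w\<close> gives the mirror image of this line.

  A line \<open>p x + q y + r = 0\<close> touches \<open>x\<^sup>2 / A - y\<^sup>2 / C = 1\<close> exactly when \<open>(p, q, r)\<close> lies on the dual
  conic \<open>A p\<^sup>2 - C q\<^sup>2 = r\<^sup>2\<close>, the point of contact being its pole \<open>(A p, - C q, - r)\<close>. For the lines
  above, this condition is \<open>dn\<^sup>2 w - (1 - k\<^sup>2) sn\<^sup>2 w = cn\<^sup>2 w\<close>, and the contact is at infinity exactly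
  when \<open>cn w = 0\<close>.

  Finally \<open>a\<^sub>0 + c\<^sub>0 = a - b\<close>, so \<open>l = a\<^sub>0 - a\<close> gives both \<open>a + l = a\<^sub>0\<close> and \<open>b + l = - c\<^sub>0\<close>.

  The functions being defined by inverting an integral, the addition theorems are obtained from
  the derivatives of \<open>sn\<close>, \<open>cn\<close>, \<open>dn\<close>, and these from the inverse function rule: the amplitude
  inverts a strictly increasing surjection with derivative \<open>1 / dn\<close>, hence has derivative \<open>dn\<close>.
\<close>

section \<open>The amplitude as the inverse of the elliptic integral\<close>

lemma elliptic_modulus_pos:
  fixes k t :: real
  assumes "k\<^sup>2 < 1"
  shows "0 < 1 - k\<^sup>2 * (sin t)\<^sup>2"
proof -
  have "(sin t)\<^sup>2 \<le> 1"
    by (simp add: abs_square_le_1)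
  then have "k\<^sup>2 * (sin t)\<^sup>2 \<le> k\<^sup>2"
    by (simp add: mult_left_le)
  then show ?thesis
    using assms by linarith
qed

lemma elliptic_F_0: "elliptic_F 0 k = 0"
  by (simp add: elliptic_F_def zero_ereal_def)

lemma has_real_derivative_elliptic_F:
  assumes "k\<^sup>2 < 1"
  shows "((\<lambda>\<phi>. elliptic_F \<phi> k) has_real_derivative 1 / sqrt (1 - k\<^sup>2 * (sin \<phi>)\<^sup>2)) (at \<phi>)"
proof -
  let ?f = "\<lambda>t. 1 / sqrt (1 - k\<^sup>2 * (sin t)\<^sup>2)"
  define m where "m = \<bar>\<phi>\<bar> + 1"
  have m: "- m < \<phi>" "\<phi> < m" "- m \<le> 0" "0 \<le> m"
    by (auto simp: m_def)
  \<comment> \<open>The interval has to contain both the base point \<open>0\<close> and \<open>\<phi>\<close>, the latter in its interior.\<close>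
  have "continuous_on {-m..m} ?f"
    using elliptic_modulus_pos[OF assms]
    by (intro continuous_intros) (auto simp: less_le)
  then have "((\<lambda>u. LBINT t=ereal 0..u. ?f t) has_vector_derivative ?f \<phi>) (at \<phi> within {-m..m})"
    using m by (intro interval_integral_FTC2) auto
  moreover have "at \<phi> within {-m..m} = at \<phi>"
    using m by (intro at_within_interior) simp
  ultimately show ?thesis
    by (simp add: elliptic_F_def zero_ereal_def has_real_derivative_iff_has_vector_derivative)
qed

lemma strict_mono_elliptic_F:
  assumes "k\<^sup>2 < 1"
  shows "strict_mono (\<lambda>\<phi>. elliptic_F \<phi> k)"
proof (rule strict_monoI)
  fix s t :: real
  assume "s < t"
  show "elliptic_F s k < elliptic_F t k"
  proof (rule DERIV_pos_imp_increasing[OF \<open>s < t\<close>], intro exI conjI)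
    fix \<phi>
    show "((\<lambda>\<phi>. elliptic_F \<phi> k) has_real_derivative 1 / sqrt (1 - k\<^sup>2 * (sin \<phi>)\<^sup>2)) (at \<phi>)"
      by (rule has_real_derivative_elliptic_F[OF assms])
    show "0 < 1 / sqrt (1 - k\<^sup>2 * (sin \<phi>)\<^sup>2)"
      using elliptic_modulus_pos[OF assms] by simp
  qed
qed

lemma isCont_elliptic_F:
  assumes "k\<^sup>2 < 1"
  shows "isCont (\<lambda>\<phi>. elliptic_F \<phi> k) \<phi>"
  using DERIV_isCont[OF has_real_derivative_elliptic_F[OF assms]] .

text \<open>The integrand is at least \<open>1\<close>, so \<open>\<phi> \<mapsto> elliptic_F \<phi> k - \<phi>\<close> is nondecreasing and the
  integral leaves every bounded set; continuity does the rest.\<close>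

lemma surj_elliptic_F:
  assumes "k\<^sup>2 < 1"
  shows "\<exists>\<phi>. elliptic_F \<phi> k = u"
proof -
  have mono: "elliptic_F s k - s \<le> elliptic_F t k - t" if "s \<le> t" for s t
  proof (rule DERIV_nonneg_imp_nondecreasing[OF that], intro exI conjI)
    fix \<phi>
    show "((\<lambda>\<phi>. elliptic_F \<phi> k - \<phi>) has_real_derivative 1 / sqrt (1 - k\<^sup>2 * (sin \<phi>)\<^sup>2) - 1) (at \<phi>)"
      by (intro derivative_intros has_real_derivative_elliptic_F[OF assms])
    have "sqrt (1 - k\<^sup>2 * (sin \<phi>)\<^sup>2) \<le> 1"
      by simp
    then show "0 \<le> 1 / sqrt (1 - k\<^sup>2 * (sin \<phi>)\<^sup>2) - 1"
      using elliptic_modulus_pos[OF assms, of \<phi>] by (simp add: le_divide_eq)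
  qed
  have "elliptic_F (- \<bar>u\<bar>) k \<le> u" "u \<le> elliptic_F \<bar>u\<bar> k"
    using mono[of "- \<bar>u\<bar>" 0] mono[of 0 "\<bar>u\<bar>"] by (auto simp: elliptic_F_0)
  then show ?thesis
    using IVT[of "\<lambda>\<phi>. elliptic_F \<phi> k" "- \<bar>u\<bar>" u "\<bar>u\<bar>"] isCont_elliptic_F[OF assms] by auto
qed

lemma jacobi_am_elliptic_F:
  assumes "k\<^sup>2 < 1"
  shows "jacobi_am (elliptic_F \<phi> k) k = \<phi>"
  unfolding jacobi_am_def
  using strict_mono_eq[OF strict_mono_elliptic_F[OF assms]] by (intro the_equality) auto

lemma elliptic_F_jacobi_am:
  assumes "k\<^sup>2 < 1"
  shows "elliptic_F (jacobi_am u k) k = u"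
  using surj_elliptic_F[OF assms, of u] jacobi_am_elliptic_F[OF assms] by auto

lemma elliptic_F_minus:
  assumes "k\<^sup>2 < 1"
  shows "elliptic_F (- \<phi>) k = - elliptic_F \<phi> k"
proof -
  have "((\<lambda>\<phi>. elliptic_F \<phi> k + elliptic_F (- \<phi>) k) has_real_derivative 0) (at t)" for t
  proof -
    have "((\<lambda>\<phi>. elliptic_F (- \<phi>) k) has_real_derivative
        1 / sqrt (1 - k\<^sup>2 * (sin (- t))\<^sup>2) * - 1) (at t)"
      by (intro DERIV_chain2[OF has_real_derivative_elliptic_F[OF assms]] derivative_eq_intros) auto
    from DERIV_add[OF has_real_derivative_elliptic_F[OF assms] this]
    show ?thesis
      by simp
  qed
  then have "elliptic_F \<phi> k + elliptic_F (- \<phi>) k = elliptic_F 0 k + elliptic_F (- 0) k"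
    by (intro DERIV_isconst_all) auto
  then show ?thesis
    by (simp add: elliptic_F_0)
qed

section \<open>Elementary properties of the Jacobi functions\<close>

lemma jacobi_am_minus:
  assumes "k\<^sup>2 < 1"
  shows "jacobi_am (- u) k = - jacobi_am u k"
  using jacobi_am_elliptic_F[OF assms, of "- jacobi_am u k"]
  by (simp add: elliptic_F_minus[OF assms] elliptic_F_jacobi_am[OF assms])

lemma jacobi_minus:
  assumes "k\<^sup>2 < 1"
  shows "jacobi_sn (- u) k = - jacobi_sn u k"
    and "jacobi_dn (- u) k = jacobi_dn u k"
  by (simp_all add: jacobi_sn_def jacobi_dn_def jacobi_am_minus[OF assms])

lemma jacobi_0:
  assumes "k\<^sup>2 < 1"
  shows "jacobi_sn 0 k = 0" "jacobi_cn 0 k = 1" "jacobi_dn 0 k = 1"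
  using jacobi_am_elliptic_F[OF assms, of 0]
  by (simp_all add: elliptic_F_0 jacobi_sn_def jacobi_cn_def jacobi_dn_def)

lemma jacobi_dn_pos:
  assumes "k\<^sup>2 < 1"
  shows "0 < jacobi_dn u k"
  using elliptic_modulus_pos[OF assms] by (simp add: jacobi_dn_def)

lemma jacobi_cn_squared: "(jacobi_cn u k)\<^sup>2 = 1 - (jacobi_sn u k)\<^sup>2"
  by (simp add: jacobi_cn_def jacobi_sn_def cos_squared_eq)

lemma jacobi_dn_squared:
  assumes "k\<^sup>2 < 1"
  shows "(jacobi_dn u k)\<^sup>2 = 1 - k\<^sup>2 * (jacobi_sn u k)\<^sup>2"
  using elliptic_modulus_pos[OF assms, of "jacobi_am u k"] by (simp add: jacobi_dn_def jacobi_sn_def)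

lemma isCont_jacobi_am:
  assumes "k\<^sup>2 < 1"
  shows "isCont (\<lambda>u. jacobi_am u k) u"
proof -
  have "isCont (\<lambda>u. jacobi_am u k) (elliptic_F (jacobi_am u k) k)"
    by (rule isCont_inverse_function[of 1])
      (auto simp: jacobi_am_elliptic_F[OF assms] isCont_elliptic_F[OF assms])
  then show ?thesis
    by (simp add: elliptic_F_jacobi_am[OF assms])
qed

lemma has_real_derivative_jacobi_am:
  assumes "k\<^sup>2 < 1"
  shows "((\<lambda>u. jacobi_am u k) has_real_derivative jacobi_dn u k) (at u)"
proof -
  have "((\<lambda>u. jacobi_am u k) has_real_derivative inverse (1 / jacobi_dn u k)) (at u)"
  proof (rule DERIV_inverse_function[of "\<lambda>\<phi>. elliptic_F \<phi> k" _ _ _ "u - 1" "u + 1"])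
    show "((\<lambda>\<phi>. elliptic_F \<phi> k) has_real_derivative 1 / jacobi_dn u k) (at (jacobi_am u k))"
      using has_real_derivative_elliptic_F[OF assms] by (simp add: jacobi_dn_def)
  qed (use jacobi_dn_pos[OF assms, of u] in
      \<open>auto simp: elliptic_F_jacobi_am[OF assms] isCont_jacobi_am[OF assms]\<close>)
  then show ?thesis
    by simp
qed

lemma has_real_derivative_jacobi_sn:
  assumes "k\<^sup>2 < 1" and "(f has_real_derivative D) (at t)"
  shows "((\<lambda>t. jacobi_sn (f t) k) has_real_derivative
           jacobi_cn (f t) k * jacobi_dn (f t) k * D) (at t)"
  using DERIV_fun_sin[OF DERIV_chain2[OF has_real_derivative_jacobi_am[OF assms(1)] assms(2)]]
  by (simp add: jacobi_sn_def jacobi_cn_def mult.assoc)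

lemma has_real_derivative_jacobi_cn:
  assumes "k\<^sup>2 < 1" and "(f has_real_derivative D) (at t)"
  shows "((\<lambda>t. jacobi_cn (f t) k) has_real_derivative
           - (jacobi_sn (f t) k * jacobi_dn (f t) k * D)) (at t)"
  using DERIV_fun_cos[OF DERIV_chain2[OF has_real_derivative_jacobi_am[OF assms(1)] assms(2)]]
  by (simp add: jacobi_sn_def jacobi_cn_def mult.assoc)

lemma has_real_derivative_jacobi_dn:
  assumes "k\<^sup>2 < 1" and "(f has_real_derivative D) (at t)"
  shows "((\<lambda>t. jacobi_dn (f t) k) has_real_derivative
           - (k\<^sup>2 * jacobi_sn (f t) k * jacobi_cn (f t) k * D)) (at t)"
proof -
  have eq: "jacobi_dn u k = sqrt (1 - k\<^sup>2 * (jacobi_sn u k)\<^sup>2)" for u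
    by (simp add: jacobi_dn_def jacobi_sn_def)
  have pos: "0 < 1 - k\<^sup>2 * (jacobi_sn u k)\<^sup>2" for u
    using elliptic_modulus_pos[OF assms(1)] by (simp add: jacobi_sn_def)
  have "((\<lambda>t. sqrt (1 - k\<^sup>2 * (jacobi_sn (f t) k)\<^sup>2)) has_real_derivative
      inverse (sqrt (1 - k\<^sup>2 * (jacobi_sn (f t) k)\<^sup>2)) / 2 *
      (- (k\<^sup>2 * (2 * jacobi_sn (f t) k * (jacobi_cn (f t) k * jacobi_dn (f t) k * D))))) (at t)"
    by (rule DERIV_chain2[where f = sqrt, OF DERIV_real_sqrt], rule pos)
      (auto intro!: derivative_eq_intros has_real_derivative_jacobi_sn[OF assms])
  then show ?thesis
    using jacobi_dn_pos[OF assms(1), of "f t"]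
    by (simp add: eq[symmetric] field_simps)
qed

section \<open>Addition theorems\<close>

lemma jacobi_addition_denominator_pos:
  assumes "k\<^sup>2 < 1"
  shows "0 < 1 - k\<^sup>2 * (jacobi_sn u k)\<^sup>2 * (jacobi_sn v k)\<^sup>2"
proof -
  have "(jacobi_sn u k)\<^sup>2 * (jacobi_sn v k)\<^sup>2 \<le> 1"
    by (simp add: jacobi_sn_def abs_square_le_1 mult_le_one)
  then have "k\<^sup>2 * ((jacobi_sn u k)\<^sup>2 * (jacobi_sn v k)\<^sup>2) \<le> k\<^sup>2"
    by (simp add: mult_left_le)
  then show ?thesis
    using assms by (simp add: mult.assoc)
qed

lemma quotient_const_of_deriv:
  fixes N M N' M' :: "real \<Rightarrow> real"
  assumes "\<And>t. (N has_real_derivative N' t) (at t)"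
    and "\<And>t. (M has_real_derivative M' t) (at t)"
    and "\<And>t. M t \<noteq> 0"
    and "\<And>t. N' t * M t = N t * M' t"
  shows "N s * M t = N t * M s"
proof -
  have "((\<lambda>t. N t / M t) has_real_derivative 0) (at t)" for t
    using DERIV_divide[OF assms(1,2,3), of t] by (simp add: assms(4))
  then have "N s / M s = N t / M t"
    by (intro DERIV_isconst_all) auto
  then show ?thesis
    using assms(3) by (simp add: field_simps)
qed

text \<open>Along \<open>u + v = w\<close> each right-hand side, divided by \<open>\<Delta>\<close>, has derivative zero: after
  replacing \<open>cn\<^sup>2\<close> and \<open>dn\<^sup>2\<close> this is a polynomial identity. The constant is the value at \<open>u = 0\<close>,
  where \<open>\<Delta> = 1\<close> and the numerators are \<open>sn w\<close>, \<open>cn w\<close> and \<open>dn w\<close>.\<close>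

theorem jacobi_addition:
  assumes k: "k\<^sup>2 < 1"
  defines "\<Delta> \<equiv> \<lambda>u v. 1 - k\<^sup>2 * (jacobi_sn u k)\<^sup>2 * (jacobi_sn v k)\<^sup>2"
  shows "jacobi_sn (u + v) k * \<Delta> u v =
      jacobi_sn u k * jacobi_cn v k * jacobi_dn v k + jacobi_sn v k * jacobi_cn u k * jacobi_dn u k"
    (is ?sn)
    and "jacobi_cn (u + v) k * \<Delta> u v =
      jacobi_cn u k * jacobi_cn v k - jacobi_sn u k * jacobi_sn v k * jacobi_dn u k * jacobi_dn v k"
    (is ?cn)
    and "jacobi_dn (u + v) k * \<Delta> u v =
      jacobi_dn u k * jacobi_dn v k - k\<^sup>2 * jacobi_sn u k * jacobi_sn v k * jacobi_cn u k * jacobi_cn v k"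
    (is ?dn)
proof -
  define w where "w = u + v"
  let ?su = "\<lambda>t. jacobi_sn t k" and ?cu = "\<lambda>t. jacobi_cn t k" and ?du = "\<lambda>t. jacobi_dn t k"
  let ?sv = "\<lambda>t. jacobi_sn (w - t) k" and ?cv = "\<lambda>t. jacobi_cn (w - t) k"
    and ?dv = "\<lambda>t. jacobi_dn (w - t) k"
  let ?M = "\<lambda>t. 1 - k\<^sup>2 * (?su t)\<^sup>2 * (?sv t)\<^sup>2"
  let ?M' = "\<lambda>t. - 2 * k\<^sup>2 * ?su t * ?sv t * (?sv t * ?cu t * ?du t - ?su t * ?cv t * ?dv t)"
  note deriv = has_real_derivative_jacobi_sn[OF k] has_real_derivative_jacobi_cn[OF k]
    has_real_derivative_jacobi_dn[OF k]
  note squares = jacobi_cn_squared[of _ k] jacobi_dn_squared[OF k]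
  have M: "(?M has_real_derivative ?M' t) (at t)" for t
    by (rule derivative_eq_intros deriv refl)+ (simp, algebra)
  have M0: "?M t \<noteq> 0" for t
    using jacobi_addition_denominator_pos[OF k, of t "w - t"] by simp
  have at_0: "?M 0 = 1" "?su 0 = 0" "?cu 0 = 1" "?du 0 = 1"
    by (simp_all add: jacobi_0[OF k])
  have v: "w - u = v"
    by (simp add: w_def)

  let ?N = "\<lambda>t. ?su t * ?cv t * ?dv t + ?sv t * ?cu t * ?du t"
  have "?N 0 * ?M u = ?N u * ?M 0"
  proof (rule quotient_const_of_deriv[OF _ M M0])
    fix t
    show "(?N has_real_derivative 2 * k\<^sup>2 * ?su t * ?sv t * ((?su t)\<^sup>2 - (?sv t)\<^sup>2)) (at t)"
      by (rule derivative_eq_intros deriv refl)+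
        (use squares[of t] squares[of "w - t"] in \<open>simp, algebra\<close>)
    show "2 * k\<^sup>2 * ?su t * ?sv t * ((?su t)\<^sup>2 - (?sv t)\<^sup>2) * ?M t = ?N t * ?M' t"
      using squares[of t] squares[of "w - t"] by algebra
  qed
  then show ?sn
    unfolding at_0 v by (simp add: \<Delta>_def w_def)

  let ?N = "\<lambda>t. ?cu t * ?cv t - ?su t * ?sv t * ?du t * ?dv t"
  let ?N' = "\<lambda>t. 2 * k\<^sup>2 * ?su t * ?sv t * (?su t * ?cu t * ?dv t - ?sv t * ?cv t * ?du t)"
  have "?N 0 * ?M u = ?N u * ?M 0"
  proof (rule quotient_const_of_deriv[OF _ M M0])
    fix t
    show "(?N has_real_derivative ?N' t) (at t)"
      by (rule derivative_eq_intros deriv refl)+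
        (use squares[of t] squares[of "w - t"] in \<open>simp, algebra\<close>)
    show "?N' t * ?M t = ?N t * ?M' t"
      using squares[of t] squares[of "w - t"] by algebra
  qed
  then show ?cn
    unfolding at_0 v by (simp add: \<Delta>_def w_def)

  let ?N = "\<lambda>t. ?du t * ?dv t - k\<^sup>2 * ?su t * ?sv t * ?cu t * ?cv t"
  let ?N' = "\<lambda>t. 2 * k\<^sup>2 * ?su t * ?sv t * (?su t * ?du t * ?cv t - ?sv t * ?dv t * ?cu t)"
  have "?N 0 * ?M u = ?N u * ?M 0"
  proof (rule quotient_const_of_deriv[OF _ M M0])
    fix t
    show "(?N has_real_derivative ?N' t) (at t)"
      by (rule derivative_eq_intros deriv refl)+
        (use squares[of t] squares[of "w - t"] in \<open>simp, algebra\<close>)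
    show "?N' t * ?M t = ?N t * ?M' t"
      using squares[of t] squares[of "w - t"] by algebra
  qed
  then show ?dn
    unfolding at_0 v by (simp add: \<Delta>_def w_def)
qed

text \<open>Expressing the functions of \<open>u + v\<close> by the addition theorems turns this into a polynomial
  identity modulo the quadratic relations for \<open>cn\<close> and \<open>dn\<close>. Its coefficients are forced: \<open>u = 0\<close> fixes the ratio of
  \<open>cn (u + v)\<close> to \<open>sn (u + v)\<close>, and \<open>v = 0\<close> that of \<open>dn (u + v)\<close> to \<open>sn (u + v)\<close>.\<close>

lemma jacobi_incidence:
  assumes k: "k\<^sup>2 < 1"
  shows "jacobi_dn (u + v) k * jacobi_sn u k + jacobi_cn (u + v) k * jacobi_sn v k =
    jacobi_sn (u + v) k * jacobi_dn u k * jacobi_cn v k"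
proof -
  let ?M = "1 - k\<^sup>2 * (jacobi_sn u k)\<^sup>2 * (jacobi_sn v k)\<^sup>2"
  have "(jacobi_dn (u + v) k * jacobi_sn u k + jacobi_cn (u + v) k * jacobi_sn v k) * ?M =
    (jacobi_sn (u + v) k * jacobi_dn u k * jacobi_cn v k) * ?M"
    using jacobi_addition[OF k, of u v] jacobi_cn_squared[of v k] jacobi_dn_squared[OF k, of u]
    by algebra
  then show ?thesis
    using jacobi_addition_denominator_pos[OF k, of u v] by simp
qed

section \<open>Tangent lines of a hyperbola\<close>

lemma straight_line_equation:
  fixes p q r :: real
  assumes "p \<noteq> 0 \<or> q \<noteq> 0"
  shows "straight_line {(x, y). p * x + q * y + r = 0}"
proof -
  have L: "{(x, y). p * x + q * y + r = 0} = {z. (p, q) \<bullet> z = - r}"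
    by (auto simp: inner_prod_def)
  have "(p, q) \<noteq> 0"
    using assms by (simp add: zero_prod_def)
  then show ?thesis
    unfolding straight_line_def L by (simp add: affine_hyperplane aff_dim_hyperplane)
qed

text \<open>The differential of the form at \<open>(A p, - C q, - r)\<close> is twice the linear form \<open>(p, q, r)\<close>, and the
  value of the form there is \<open>A p\<^sup>2 - C q\<^sup>2 - r\<^sup>2\<close>. The factor \<open>t\<close> rescales the homogeneous
  coordinates of the point of contact, which allows its last one to be made \<open>1\<close> if \<open>r \<noteq> 0\<close>.\<close>

lemma proj_tangent_at_pole:
  assumes "A \<noteq> 0" "C \<noteq> 0" "p \<noteq> 0 \<or> q \<noteq> 0" "t \<noteq> 0"
    and dual: "A * p\<^sup>2 - C * q\<^sup>2 = r\<^sup>2"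
  shows "proj_tangent_at (hyperbola_form A C) (t * (A * p), - (t * (C * q)), - (t * r))
    {(x, y). p * x + q * y + r = 0}"
proof -
  define D :: "real \<times> real \<times> real \<Rightarrow> real"
    where "D = (\<lambda>(h, i, j). 2 * t * (p * h + q * i + r * j))"
  have form: "hyperbola_form A C =
      (\<lambda>P. (fst P)\<^sup>2 / A - (fst (snd P))\<^sup>2 / C - (snd (snd P))\<^sup>2)"
    by (auto simp: hyperbola_form_def)
  have "(hyperbola_form A C has_derivative D) (at (t * (A * p), - (t * (C * q)), - (t * r)))"
    unfolding form D_def
    using assms(1,2) by (auto intro!: derivative_eq_intros simp: fun_eq_iff field_simps)
  moreover have "D \<noteq> (\<lambda>_. 0)"
  proof
    assume "D = (\<lambda>_. 0)"
    \<comment> \<open>On \<open>(p, q, 0)\<close> the differential is \<open>2 t (p\<^sup>2 + q\<^sup>2)\<close>.\<close>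
    then have "D (p, q, 0) = 0"
      by simp
    then show False
      using assms by (auto simp: D_def sum_power2_eq_zero_iff simp flip: power2_eq_square)
  qed
  moreover have "hyperbola_form A C (t * (A * p), - (t * (C * q)), - (t * r)) =
      t\<^sup>2 * (A * p\<^sup>2 - C * q\<^sup>2 - r\<^sup>2)"
    using assms(1,2) by (simp add: hyperbola_form_def field_simps power2_eq_square)
  ultimately show ?thesis
    unfolding proj_tangent_at_def
    using assms by (auto simp: zero_prod_def D_def)
qed

lemma tangent_line_hyperbola:
  assumes "A \<noteq> 0" "C \<noteq> 0" "p \<noteq> 0 \<or> q \<noteq> 0" "A * p\<^sup>2 - C * q\<^sup>2 = r\<^sup>2"
  defines "L \<equiv> {(x, y). p * x + q * y + r = 0}"
  shows "tangent_to_hyperbola A C L"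
    and "r \<noteq> 0 \<Longrightarrow> affinely_tangent_to_hyperbola A C L"
proof -
  show "tangent_to_hyperbola A C L"
    unfolding tangent_to_hyperbola_def L_def
    using proj_tangent_at_pole[OF assms(1-3) one_neq_zero assms(4)] by blast
next
  assume "r \<noteq> 0"
  then have t: "proj_tangent_at (hyperbola_form A C) (- A * p / r, C * q / r, 1) L"
    unfolding L_def
    using proj_tangent_at_pole[OF assms(1-3) _ assms(4), of "- 1 / r"] by simp
  then have "(- A * p / r, C * q / r) \<in> hyperbola A C"
    by (simp add: proj_tangent_at_def hyperbola_form_def hyperbola_def)
  with t show "affinely_tangent_to_hyperbola A C L"
    unfolding affinely_tangent_to_hyperbola_def by blast
qed

theorem proposition8p3:
  fixes a b k \<alpha>\<^sub>1 \<alpha>\<^sub>2 \<beta>\<^sub>1 \<beta>\<^sub>2 a\<^sub>0 c\<^sub>0 :: real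
    and f\<^sub>1 f\<^sub>2 g\<^sub>1 g\<^sub>2 :: "real \<Rightarrow> real"
    and x y :: "real \<Rightarrow> real \<Rightarrow> real"
  assumes "a > b" and "0 < k" and "k < 1"
    and "\<alpha>\<^sub>1 = k * sqrt (a - b)"
    and "\<alpha>\<^sub>2 = sqrt (a - b)" and "\<beta>\<^sub>1 = sqrt (a - b)" and "\<beta>\<^sub>2 = sqrt (a - b)"
    and "\<And>s. f\<^sub>1 s = \<alpha>\<^sub>1 * jacobi_sn s k"
    and "\<And>s. g\<^sub>1 s = \<beta>\<^sub>1 * jacobi_dn s k"
    and "\<And>s. f\<^sub>2 s = \<alpha>\<^sub>2 * (1 / jacobi_sn s k)"
    and "\<And>s. g\<^sub>2 s = \<beta>\<^sub>2 * (jacobi_cn s k / jacobi_sn s k)"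
    and "\<And>s\<^sub>1 s\<^sub>2. x s\<^sub>1 s\<^sub>2 = f\<^sub>1 s\<^sub>1 * f\<^sub>2 s\<^sub>2 / sqrt (a - b)"
    and "\<And>s\<^sub>1 s\<^sub>2. y s\<^sub>1 s\<^sub>2 = g\<^sub>1 s\<^sub>1 * g\<^sub>2 s\<^sub>2 / sqrt (a - b)"
    and "a\<^sub>0 = k\<^sup>2 * (a - b)" and "c\<^sub>0 = (1 - k\<^sup>2) * (a - b)"
  shows "(\<forall>\<xi>. \<exists>L. straight_line L
            \<and> (\<forall>s\<^sub>1 s\<^sub>2. jacobi_sn s\<^sub>2 k \<noteq> 0 \<and> s\<^sub>1 + s\<^sub>2 = \<xi> \<longrightarrow> (x s\<^sub>1 s\<^sub>2, y s\<^sub>1 s\<^sub>2) \<in> L)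
            \<and> tangent_to_hyperbola a\<^sub>0 c\<^sub>0 L
            \<and> (jacobi_cn \<xi> k \<noteq> 0 \<longrightarrow> affinely_tangent_to_hyperbola a\<^sub>0 c\<^sub>0 L))
       \<and> (\<forall>\<eta>. \<exists>L. straight_line L
            \<and> (\<forall>s\<^sub>1 s\<^sub>2. jacobi_sn s\<^sub>2 k \<noteq> 0 \<and> s\<^sub>2 - s\<^sub>1 = \<eta> \<longrightarrow> (x s\<^sub>1 s\<^sub>2, y s\<^sub>1 s\<^sub>2) \<in> L)
            \<and> tangent_to_hyperbola a\<^sub>0 c\<^sub>0 L
            \<and> (jacobi_cn \<eta> k \<noteq> 0 \<longrightarrow> affinely_tangent_to_hyperbola a\<^sub>0 c\<^sub>0 L))
       \<and> (\<exists>l. a + l \<noteq> 0 \<and> b + l \<noteq> 0 \<and> hyperbola a\<^sub>0 c\<^sub>0 = confocal_conic a b l)"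
proof -
  define d where "d = sqrt (a - b)"
  have d: "0 < d" "d\<^sup>2 = a - b"
    using \<open>a > b\<close> by (simp_all add: d_def)
  have k: "k\<^sup>2 < 1"
    using \<open>0 < k\<close> \<open>k < 1\<close> by (simp add: power_less_one_iff)
  have nz: "a\<^sub>0 \<noteq> 0" "c\<^sub>0 \<noteq> 0"
    using assms(1,2) k by (simp_all add: \<open>a\<^sub>0 = _\<close> \<open>c\<^sub>0 = _\<close>)
  have x: "x s t = k * d * jacobi_sn s k / jacobi_sn t k" for s t
    using d(1) unfolding assms(12) assms(8,10) assms(4,5) d_def[symmetric] by simp
  have y: "y s t = d * jacobi_dn s k * jacobi_cn t k / jacobi_sn t k" for s t
    using d(1) unfolding assms(13) assms(9,11) assms(6,7) d_def[symmetric] by simp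
  have dual: "a\<^sub>0 * (\<sigma> * jacobi_dn w k / k)\<^sup>2 - c\<^sub>0 * (- jacobi_sn w k)\<^sup>2 = (d * jacobi_cn w k)\<^sup>2"
    if "\<sigma>\<^sup>2 = 1" for \<sigma> w
  proof -
    have "a\<^sub>0 * (\<sigma> * jacobi_dn w k / k)\<^sup>2 = (a - b) * (jacobi_dn w k)\<^sup>2"
      using \<open>0 < k\<close> that by (simp add: \<open>a\<^sub>0 = _\<close> power_mult_distrib power_divide)
    then show ?thesis
      unfolding \<open>c\<^sub>0 = _\<close> power_mult_distrib d(2) jacobi_cn_squared jacobi_dn_squared[OF k]
      by (simp add: algebra_simps)
  qed
  \<comment> \<open>The sign \<open>\<sigma>\<close> treats both families together: \<open>1\<close> for constant \<open>s\<^sub>1 + s\<^sub>2\<close>, \<open>- 1\<close> for constant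
    \<open>s\<^sub>2 - s\<^sub>1\<close>. It enters the line through the parity of \<open>sn\<close> and \<open>dn\<close>.\<close>
  have line: "\<exists>L. straight_line L
      \<and> (\<forall>s\<^sub>1 s\<^sub>2. jacobi_sn s\<^sub>2 k \<noteq> 0 \<and> \<sigma> * s\<^sub>1 + s\<^sub>2 = w \<longrightarrow> (x s\<^sub>1 s\<^sub>2, y s\<^sub>1 s\<^sub>2) \<in> L)
      \<and> tangent_to_hyperbola a\<^sub>0 c\<^sub>0 L
      \<and> (jacobi_cn w k \<noteq> 0 \<longrightarrow> affinely_tangent_to_hyperbola a\<^sub>0 c\<^sub>0 L)"
    if \<sigma>: "\<sigma> = 1 \<or> \<sigma> = - 1" for \<sigma> w
  proof -
    let ?p = "\<sigma> * jacobi_dn w k / k" and ?q = "- jacobi_sn w k" and ?r = "d * jacobi_cn w k"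
    let ?L = "{(x, y). ?p * x + ?q * y + ?r = 0}"
    have p: "?p \<noteq> 0 \<or> ?q \<noteq> 0"
      using jacobi_dn_pos[OF k, of w] \<sigma> \<open>0 < k\<close> by auto
    have "\<sigma>\<^sup>2 = 1"
      using \<sigma> by auto
    note tangent = tangent_line_hyperbola[OF nz p dual[OF this]]
    have "(x s t, y s t) \<in> ?L" if t: "jacobi_sn t k \<noteq> 0" and w: "\<sigma> * s + t = w" for s t
    proof -
      have parity: "jacobi_sn (\<sigma> * s) k = \<sigma> * jacobi_sn s k" "jacobi_dn (\<sigma> * s) k = jacobi_dn s k"
        using \<sigma> by (auto simp: jacobi_minus[OF k])
      have "?p * x s t + ?q * y s t + ?r = d / jacobi_sn t k *
          (jacobi_dn w k * (\<sigma> * jacobi_sn s k) + jacobi_cn w k * jacobi_sn t k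
            - jacobi_sn w k * jacobi_dn s k * jacobi_cn t k)"
        unfolding x y using \<open>0 < k\<close> t by (simp add: field_simps)
      also have "\<dots> = 0"
        using jacobi_incidence[OF k, of "\<sigma> * s" t] unfolding w parity by simp
      finally show ?thesis
        by simp
    qed
    then show ?thesis
      using straight_line_equation[OF p, of ?r] tangent d(1) by (intro exI[of _ ?L]) auto
  qed
  have "\<exists>l. a + l \<noteq> 0 \<and> b + l \<noteq> 0 \<and> hyperbola a\<^sub>0 c\<^sub>0 = confocal_conic a b l"
  proof (intro exI[of _ "a\<^sub>0 - a"])
    have "a + (a\<^sub>0 - a) = a\<^sub>0" "b + (a\<^sub>0 - a) = - c\<^sub>0"
      by (simp_all add: \<open>a\<^sub>0 = _\<close> \<open>c\<^sub>0 = _\<close> algebra_simps)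
    then show "a + (a\<^sub>0 - a) \<noteq> 0 \<and> b + (a\<^sub>0 - a) \<noteq> 0 \<and> hyperbola a\<^sub>0 c\<^sub>0 = confocal_conic a b (a\<^sub>0 - a)"
      using nz by (simp add: hyperbola_def confocal_conic_def)
  qed
  then show ?thesis
    using line[of 1] line[of "- 1"] by simp
qed

end
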